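(* Let $\mathcal{R}$ be a commutative ring with unity and $k\in\mathbb{N}$. Let $\mathcal{I}\subsetneq\mathcal{R}$ be an ideal which satisfies the unital set condition (USC). Then the reduction map $SP_{2k}(\mathcal{R})\longrightarrow SP_{2k}(\mathcal{R}/\mathcal{I})$ is surjective.
   Context: For a commutative ring $\mathcal{S}$ with unity, $SP_{2k}(\mathcal{S})=\{A\in M_{2k\times 2k}(\mathcal{S})\mid A^tJA=J\}$ where $J=\begin{pmatrix}0_{k\times k}& I_{k\times k}\\ -I_{k\times k}&0_{k\times k}\end{pmatrix}$. A finite subset $\{a_1,\ldots,a_n\}\subseteq\mathcal{R}$ (repetitions allowed) is unital if it generates the unit ideal. An ideal $\mathcal{I}\subsetneq\mathcal{R}$ satisfies the USC if for every $n\ge 2$ and every unital set $\{a_1,\ldots,a_n\}\subseteq\mathcal{R}$ there exists $b\in\langle a_2,\ldots,a_n\rangle$ such that $a_1+b$ is a unit modulo $\mathcal{I}$. *)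

theory Defs
  imports "Jordan_Normal_Form.Matrix" "HOL-Algebra.QuotRing"
begin

text \<open>
  The matrix type of \<open>Jordan_Normal_Form\<close> is used only as a container for rectangular arrays.
  Its arithmetic is tied to type classes, which cannot describe the quotient of a ring by an
  arbitrary ideal, so the ring-dependent operations are given here relative to an explicit
  ring \<open>R\<close>.
\<close>

definition mats_over :: "('a, 'm) ring_scheme \<Rightarrow> nat \<Rightarrow> nat \<Rightarrow> 'a mat set" where
  "mats_over R m n = {A \<in> carrier_mat m n. \<forall>i<m. \<forall>j<n. A $$ (i, j) \<in> carrier R}"

definition zero_mat_over :: "('a, 'm) ring_scheme \<Rightarrow> nat \<Rightarrow> nat \<Rightarrow> 'a mat" where
  "zero_mat_over R m n = mat m n (\<lambda>(i, j). \<zero>\<^bsub>R\<^esub>)"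

definition one_mat_over :: "('a, 'm) ring_scheme \<Rightarrow> nat \<Rightarrow> 'a mat" where
  "one_mat_over R n = mat n n (\<lambda>(i, j). if i = j then \<one>\<^bsub>R\<^esub> else \<zero>\<^bsub>R\<^esub>)"

definition uminus_mat_over :: "('a, 'm) ring_scheme \<Rightarrow> 'a mat \<Rightarrow> 'a mat" where
  "uminus_mat_over R A = map_mat (\<lambda>x. \<ominus>\<^bsub>R\<^esub> x) A"

definition mult_mat_over :: "('a, 'm) ring_scheme \<Rightarrow> 'a mat \<Rightarrow> 'a mat \<Rightarrow> 'a mat" where
  "mult_mat_over R A B = mat (dim_row A) (dim_col B)
     (\<lambda>(i, j). \<Oplus>\<^bsub>R\<^esub>l\<in>{..<dim_col A}. A $$ (i, l) \<otimes>\<^bsub>R\<^esub> B $$ (l, j))"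

definition symp_J :: "('a, 'm) ring_scheme \<Rightarrow> nat \<Rightarrow> 'a mat" where
  "symp_J R k = four_block_mat
     (zero_mat_over R k k) (one_mat_over R k)
     (uminus_mat_over R (one_mat_over R k)) (zero_mat_over R k k)"

text \<open>\<open>SP R k\<close> is the symplectic group of \<open>2k \<times> 2k\<close> matrices; \<open>k\<close> is half the matrix size.\<close>

definition SP :: "('a, 'm) ring_scheme \<Rightarrow> nat \<Rightarrow> 'a mat set" where
  "SP R k = {A \<in> mats_over R (2 * k) (2 * k).
     mult_mat_over R (mult_mat_over R (transpose_mat A) (symp_J R k)) A = symp_J R k}"

definition reduction_map :: "('a, 'm) ring_scheme \<Rightarrow> 'a set \<Rightarrow> 'a mat \<Rightarrow> 'a set mat" where
  "reduction_map R I = map_mat (\<lambda>x. I +>\<^bsub>R\<^esub> x)"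

text \<open>Finite sets with repetitions and a distinguished first member are represented by lists.\<close>

definition unital :: "('a, 'm) ring_scheme \<Rightarrow> 'a list \<Rightarrow> bool" where
  "unital R as \<longleftrightarrow> set as \<subseteq> carrier R \<and> Idl\<^bsub>R\<^esub> (set as) = carrier R"

definition USC :: "('a, 'm) ring_scheme \<Rightarrow> 'a set \<Rightarrow> bool" where
  "USC R I \<longleftrightarrow> (\<forall>as. length as \<ge> 2 \<longrightarrow> unital R as \<longrightarrow>
     (\<exists>b \<in> Idl\<^bsub>R\<^esub> (set (tl as)). I +>\<^bsub>R\<^esub> (hd as \<oplus>\<^bsub>R\<^esub> b) \<in> Units (R Quot I)))"

end

theory Submission
  imports Defs
begin

text \<open>
  The USC says that \<open>S = R/I\<close> has stable range one. Over any commutative ring the transvections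
  \<open>x \<mapsto> x + a \<omega>(u, x) u\<close> are symplectic, and over \<open>S\<close> they lift to \<open>R\<close> by lifting \<open>u\<close> and \<open>a\<close>.
  If \<open>\<omega>(w, v)\<close> is a unit, then the transvection with \<open>u = w - v\<close> and \<open>a = \<omega>(w, v)\<^sup>-\<^sup>1\<close> maps \<open>v\<close> to
  \<open>w\<close>. Stable range one yields an intermediate vector through which two such transvections take the
  \<open>j\<close>-th column of a symplectic matrix to \<open>e\<^sub>j\<close>. Two more fix \<open>e\<^sub>j\<close> and take the \<open>(k+j)\<close>-th
  column to \<open>e\<^bsub>k+j\<^esub>\<close>, and all of them fix the basis vectors reached before. Hence every symplectic
  matrix over \<open>S\<close> is a product of \<open>4k\<close> transvections.
\<close>

section \<open>Vectors, the symplectic form and symplectic families\<close>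

text \<open>
  Vectors vanish beyond index \<open>2k\<close>, so that equality of vectors is equality of functions.
\<close>

definition vecs :: "('a, 'm) ring_scheme \<Rightarrow> nat \<Rightarrow> (nat \<Rightarrow> 'a) set" where
  "vecs R k = {x. (\<forall>l. x l \<in> carrier R) \<and> (\<forall>l\<ge>2 * k. x l = \<zero>\<^bsub>R\<^esub>)}"

definition basis_vec :: "('a, 'm) ring_scheme \<Rightarrow> nat \<Rightarrow> nat \<Rightarrow> 'a" where
  "basis_vec R i = (\<lambda>l. if l = i then \<one>\<^bsub>R\<^esub> else \<zero>\<^bsub>R\<^esub>)"

definition add_scaled :: "('a, 'm) ring_scheme \<Rightarrow> (nat \<Rightarrow> 'a) \<Rightarrow> 'a \<Rightarrow> (nat \<Rightarrow> 'a) \<Rightarrow> nat \<Rightarrow> 'a" where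
  "add_scaled R x a u = (\<lambda>l. x l \<oplus>\<^bsub>R\<^esub> a \<otimes>\<^bsub>R\<^esub> u l)"

definition symp_form :: "('a, 'm) ring_scheme \<Rightarrow> nat \<Rightarrow> (nat \<Rightarrow> 'a) \<Rightarrow> (nat \<Rightarrow> 'a) \<Rightarrow> 'a" where
  "symp_form R k x y =
     (\<Oplus>\<^bsub>R\<^esub>i\<in>{..<k}. x i \<otimes>\<^bsub>R\<^esub> y (k + i) \<ominus>\<^bsub>R\<^esub> x (k + i) \<otimes>\<^bsub>R\<^esub> y i)"

definition transvection ::
    "('a, 'm) ring_scheme \<Rightarrow> nat \<Rightarrow> (nat \<Rightarrow> 'a) \<Rightarrow> 'a \<Rightarrow> (nat \<Rightarrow> 'a) \<Rightarrow> nat \<Rightarrow> 'a" where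
  "transvection R k u a x = add_scaled R x (a \<otimes>\<^bsub>R\<^esub> symp_form R k u x) u"

definition J_entry :: "('a, 'm) ring_scheme \<Rightarrow> nat \<Rightarrow> nat \<Rightarrow> nat \<Rightarrow> 'a" where
  "J_entry R k i j =
     (if j = k + i then \<one>\<^bsub>R\<^esub> else if i = k + j then \<ominus>\<^bsub>R\<^esub> \<one>\<^bsub>R\<^esub> else \<zero>\<^bsub>R\<^esub>)"

text \<open>A symplectic matrix seen through its columns, whose Gram matrix is \<open>J\<close>.
  Vectors at indices from \<open>2 * k\<close> on are unconstrained.\<close>

definition symp_family :: "('a, 'm) ring_scheme \<Rightarrow> nat \<Rightarrow> (nat \<Rightarrow> nat \<Rightarrow> 'a) \<Rightarrow> bool" where
  "symp_family R k c \<longleftrightarrow> (\<forall>i<2 * k. c i \<in> vecs R k) \<and>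
     (\<forall>i<2 * k. \<forall>j<2 * k. symp_form R k (c i) (c j) = J_entry R k i j)"

text \<open>The vectors at \<open>i\<close> and \<open>k + i\<close> form a hyperbolic pair; the
  reduction handles one pair at a time.\<close>

definition agrees_with_basis :: "('a, 'm) ring_scheme \<Rightarrow> nat \<Rightarrow> nat \<Rightarrow> (nat \<Rightarrow> nat \<Rightarrow> 'a) \<Rightarrow> bool" where
  "agrees_with_basis R k j c \<longleftrightarrow>
     (\<forall>i<j. c i = basis_vec R i \<and> c (k + i) = basis_vec R (k + i))"

text \<open>For \<open>j \<le> k\<close> and vectors in \<open>vecs R k\<close> this is
  orthogonality to the first \<open>j\<close> hyperbolic pairs of basis vectors.\<close>

definition vanishes_below :: "('a, 'm) ring_scheme \<Rightarrow> nat \<Rightarrow> nat \<Rightarrow> (nat \<Rightarrow> 'a) \<Rightarrow> bool" where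
  "vanishes_below R k j x \<longleftrightarrow> (\<forall>i<j. x i = \<zero>\<^bsub>R\<^esub> \<and> x (k + i) = \<zero>\<^bsub>R\<^esub>)"

text \<open>Bass's condition for unimodular rows \<open>(x, y)\<close>, with the coefficient of
  \<open>y\<close> in the Bezout relation absorbed into \<open>r\<close>.\<close>

definition stable_range_one :: "('a, 'm) ring_scheme \<Rightarrow> bool" where
  "stable_range_one R \<longleftrightarrow> (\<forall>x\<in>carrier R. \<forall>p\<in>carrier R. \<forall>r\<in>carrier R.
     x \<otimes>\<^bsub>R\<^esub> p \<oplus>\<^bsub>R\<^esub> r = \<one>\<^bsub>R\<^esub> \<longrightarrow> (\<exists>t\<in>carrier R. x \<oplus>\<^bsub>R\<^esub> t \<otimes>\<^bsub>R\<^esub> r \<in> Units R))"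

section \<open>The alternating form and its transvections\<close>

context cring
begin

lemma basis_vec_in_vecs [simp]: "i < 2 * k \<Longrightarrow> basis_vec R i \<in> vecs R k"
  by (auto simp: vecs_def basis_vec_def)

lemma add_scaled_in_vecs [simp]:
  "\<lbrakk>x \<in> vecs R k; u \<in> vecs R k; a \<in> carrier R\<rbrakk> \<Longrightarrow> add_scaled R x a u \<in> vecs R k"
  by (auto simp: vecs_def add_scaled_def)

lemma vecs_carrier [simp]: "x \<in> vecs R k \<Longrightarrow> x l \<in> carrier R"
  by (simp add: vecs_def)

lemma symp_form_closed [simp]:
  "\<lbrakk>x \<in> vecs R k; y \<in> vecs R k\<rbrakk> \<Longrightarrow> symp_form R k x y \<in> carrier R"
  unfolding symp_form_def by (rule finsum_closed) auto

lemma transvection_in_vecs [simp]: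
  "\<lbrakk>x \<in> vecs R k; u \<in> vecs R k; a \<in> carrier R\<rbrakk> \<Longrightarrow> transvection R k u a x \<in> vecs R k"
  by (simp add: transvection_def)

lemma symp_form_add_scaled_left:
  assumes "x \<in> vecs R k" "u \<in> vecs R k" "y \<in> vecs R k" "a \<in> carrier R"
  shows "symp_form R k (add_scaled R x a u) y = symp_form R k x y \<oplus> a \<otimes> symp_form R k u y"
proof -
  have "symp_form R k (add_scaled R x a u) y =
      (\<Oplus>i\<in>{..<k}. (x i \<otimes> y (k + i) \<ominus> x (k + i) \<otimes> y i) \<oplus>
         a \<otimes> (u i \<otimes> y (k + i) \<ominus> u (k + i) \<otimes> y i))"
    unfolding symp_form_def
  proof (rule finsum_cong')
    fix i
    have "x i \<in> carrier R" "x (k + i) \<in> carrier R" "y i \<in> carrier R" "y (k + i) \<in> carrier R"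
      "u i \<in> carrier R" "u (k + i) \<in> carrier R"
      using assms by auto
    with \<open>a \<in> carrier R\<close>
    show "add_scaled R x a u i \<otimes> y (k + i) \<ominus> add_scaled R x a u (k + i) \<otimes> y i =
      (x i \<otimes> y (k + i) \<ominus> x (k + i) \<otimes> y i) \<oplus> a \<otimes> (u i \<otimes> y (k + i) \<ominus> u (k + i) \<otimes> y i)"
      unfolding add_scaled_def by algebra
  qed (use assms in auto)
  also have "\<dots> = symp_form R k x y \<oplus> a \<otimes> symp_form R k u y"
    unfolding symp_form_def using assms
    by (subst finsum_addf) (auto simp: finsum_rdistr)
  finally show ?thesis .
qed

text \<open>Each summand vanishes by commutativity. Antisymmetry alone would only show that twice
  the value is zero.\<close>

lemma symp_form_self [simp]:
  assumes "x \<in> vecs R k"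
  shows "symp_form R k x x = \<zero>"
proof -
  have "symp_form R k x x = (\<Oplus>i\<in>{..<k}. \<zero>)"
    unfolding symp_form_def
  proof (rule finsum_cong')
    fix i
    have "x i \<in> carrier R" "x (k + i) \<in> carrier R"
      using assms by auto
    then show "x i \<otimes> x (k + i) \<ominus> x (k + i) \<otimes> x i = \<zero>"
      by algebra
  qed auto
  then show ?thesis by simp
qed

lemma symp_form_commute:
  assumes "x \<in> vecs R k" "y \<in> vecs R k"
  shows "symp_form R k y x = \<ominus> symp_form R k x y"
proof -
  have "symp_form R k y x \<oplus> symp_form R k x y = (\<Oplus>i\<in>{..<k}. \<zero>)"
    unfolding symp_form_def using assms
  proof (subst finsum_addf [symmetric], goal_cases)
    case 3
    show ?case
    proof (rule finsum_cong')
      fix i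
      have "x i \<in> carrier R" "x (k + i) \<in> carrier R" "y i \<in> carrier R" "y (k + i) \<in> carrier R"
        using assms by auto
      then show "(y i \<otimes> x (k + i) \<ominus> y (k + i) \<otimes> x i) \<oplus> (x i \<otimes> y (k + i) \<ominus> x (k + i) \<otimes> y i) = \<zero>"
        by algebra
    qed auto
  qed auto
  then show ?thesis
    using assms by (simp add: minus_equality)
qed

lemma symp_form_add_scaled_right:
  assumes "x \<in> vecs R k" "u \<in> vecs R k" "y \<in> vecs R k" "a \<in> carrier R"
  shows "symp_form R k y (add_scaled R x a u) = symp_form R k y x \<oplus> a \<otimes> symp_form R k y u"
proof -
  have c: "symp_form R k x y \<in> carrier R" "symp_form R k u y \<in> carrier R"
    using assms by auto
  have "symp_form R k y (add_scaled R x a u) = \<ominus> (symp_form R k x y \<oplus> a \<otimes> symp_form R k u y)"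
    using assms by (simp add: symp_form_commute[of "add_scaled R x a u" k y] symp_form_add_scaled_left)
  also have "\<dots> = \<ominus> symp_form R k x y \<oplus> a \<otimes> \<ominus> symp_form R k u y"
    using c assms(4) by (simp add: minus_add r_minus)
  also have "\<dots> = symp_form R k y x \<oplus> a \<otimes> symp_form R k y u"
    using assms by (simp only: symp_form_commute[of x k y] symp_form_commute[of u k y])
  finally show ?thesis .
qed

text \<open>The two cross terms are \<open>a\<close> times the product of \<omega>(u, x) and
  \<omega>(u, y), with opposite signs by antisymmetry; the remaining term contains \<omega>(u, u) =
  0.\<close>

lemma symp_form_transvection:
  assumes "x \<in> vecs R k" "u \<in> vecs R k" "y \<in> vecs R k" "a \<in> carrier R"
  shows "symp_form R k (transvection R k u a x) (transvection R k u a y) = symp_form R k x y"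
proof -
  have c: "symp_form R k x y \<in> carrier R" "symp_form R k u y \<in> carrier R" "symp_form R k u x \<in> carrier R"
    using assms by auto
  have u: "symp_form R k u (transvection R k u a y) = symp_form R k u y"
    using assms by (simp add: transvection_def symp_form_add_scaled_right)
  have x: "symp_form R k x (transvection R k u a y) =
      symp_form R k x y \<oplus> (a \<otimes> symp_form R k u y) \<otimes> \<ominus> symp_form R k u x"
    using assms by (simp add: transvection_def symp_form_add_scaled_right symp_form_commute[of u k x])
  have "symp_form R k (transvection R k u a x) (transvection R k u a y) =
      (symp_form R k x y \<oplus> (a \<otimes> symp_form R k u y) \<otimes> \<ominus> symp_form R k u x)
        \<oplus> (a \<otimes> symp_form R k u x) \<otimes> symp_form R k u y"
    unfolding transvection_def[of R k u a x]
    using assms by (simp add: symp_form_add_scaled_left x u)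
  also have "\<dots> = symp_form R k x y"
    using c assms(4) by algebra
  finally show ?thesis .
qed

lemma transvection_fixes:
  assumes "x \<in> vecs R k" "u \<in> vecs R k" "a \<in> carrier R" "symp_form R k u x = \<zero>"
  shows "transvection R k u a x = x"
  using assms by (simp add: transvection_def add_scaled_def)

text \<open>As \<omega>(u, u) = 0, the first transvection leaves \<omega>(u, x) unchanged, so the
  second adds exactly the opposite multiple of \<open>u\<close>.\<close>

lemma transvection_inverse:
  assumes "x \<in> vecs R k" "u \<in> vecs R k" "a \<in> carrier R"
  shows "transvection R k u (\<ominus> a) (transvection R k u a x) = x"
proof -
  have c: "symp_form R k u x \<in> carrier R"
    using assms by auto
  have "symp_form R k u (transvection R k u a x) = symp_form R k u x"
    using assms by (simp add: transvection_def symp_form_add_scaled_right)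
  moreover have "x l \<oplus> (a \<otimes> symp_form R k u x) \<otimes> u l \<oplus> (\<ominus> a \<otimes> symp_form R k u x) \<otimes> u l = x l" for l
  proof -
    have "x l \<in> carrier R" "u l \<in> carrier R" using assms by auto
    with c assms(3) show ?thesis by algebra
  qed
  ultimately show ?thesis
    by (simp add: transvection_def add_scaled_def fun_eq_iff)
qed

text \<open>As \<omega>(v, v) = 0, the product \<omega>(w - v, v) equals \<omega>(w, v); the scalar
  cancels it, and exactly w - v is added to \<open>v\<close>.\<close>

lemma transvection_maps:
  assumes "v \<in> vecs R k" "w \<in> vecs R k" "symp_form R k w v \<in> Units R"
  shows "transvection R k (add_scaled R w (\<ominus> \<one>) v) (inv (symp_form R k w v)) v = w"
proof -
  have "symp_form R k (add_scaled R w (\<ominus> \<one>) v) v = symp_form R k w v"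
    using assms by (simp add: symp_form_add_scaled_left)
  moreover have "v l \<oplus> \<one> \<otimes> (w l \<oplus> \<ominus> \<one> \<otimes> v l) = w l" for l
  proof -
    have "v l \<in> carrier R" "w l \<in> carrier R" using assms by auto
    then show ?thesis by algebra
  qed
  ultimately show ?thesis
    using assms(3) by (simp add: transvection_def Units_l_inv) (simp add: add_scaled_def fun_eq_iff)
qed

section \<open>Products with basis vectors\<close>

lemma symp_form_basis_low:
  assumes "i < k" "x \<in> vecs R k"
  shows "symp_form R k (basis_vec R i) x = x (k + i)"
proof -
  have "symp_form R k (basis_vec R i) x = (\<Oplus>j\<in>{..<k}. if i = j then x (k + j) else \<zero>)"
    unfolding symp_form_def basis_vec_def
    by (rule finsum_cong') (use assms in \<open>auto simp: a_minus_def\<close>)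
  also have "\<dots> = x (k + i)"
    using assms by (subst finsum_singleton) auto
  finally show ?thesis .
qed

lemma symp_form_basis_high:
  assumes "i < k" "x \<in> vecs R k"
  shows "symp_form R k (basis_vec R (k + i)) x = \<ominus> x i"
proof -
  have "symp_form R k (basis_vec R (k + i)) x = (\<Oplus>j\<in>{..<k}. if i = j then \<ominus> x j else \<zero>)"
    unfolding symp_form_def basis_vec_def
    by (rule finsum_cong') (use assms in \<open>auto simp: a_minus_def\<close>)
  also have "\<dots> = \<ominus> x i"
    using assms by (subst finsum_singleton) auto
  finally show ?thesis .
qed

lemma symp_family_basis: "symp_family R k (basis_vec R)"
proof -
  have "symp_form R k (basis_vec R i) (basis_vec R j) = J_entry R k i j"
    if "i < 2 * k" "j < 2 * k" for i j
  proof (cases "i < k")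
    case True
    then show ?thesis
      using that by (simp add: symp_form_basis_low) (auto simp: J_entry_def basis_vec_def)
  next
    case False
    then have "i = k + (i - k)" "i - k < k"
      using that by auto
    then obtain i' where "i = k + i'" "i' < k"
      by blast
    then show ?thesis
      using that by (simp add: symp_form_basis_high) (auto simp: J_entry_def basis_vec_def)
  qed
  then show ?thesis by (simp add: symp_family_def)
qed

lemma symp_family_transvection:
  assumes "symp_family R k c" "u \<in> vecs R k" "a \<in> carrier R"
  shows "symp_family R k (\<lambda>i. transvection R k u a (c i))"
  using assms by (simp add: symp_family_def symp_form_transvection)


section \<open>Reduction of a symplectic family to the standard basis\<close>

lemma Units_uminus:
  assumes "x \<in> Units R"
  shows "\<ominus> x \<in> Units R"
proof -
  have "\<ominus> x = \<ominus> \<one> \<otimes> x"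
    using assms by (simp add: l_minus Units_closed)
  then show ?thesis
    using assms by (metis Units_m_closed Units_minus_one_closed)
qed

lemma symp_form_high_right:
  assumes "i < k" "x \<in> vecs R k"
  shows "symp_form R k x (basis_vec R (k + i)) = x i"
  using assms by (simp add: symp_form_commute[of "basis_vec R (k + i)" k x] symp_form_basis_high)

lemma symp_form_low_right:
  assumes "i < k" "x \<in> vecs R k"
  shows "symp_form R k x (basis_vec R i) = \<ominus> x (k + i)"
  using assms by (simp add: symp_form_commute[of "basis_vec R i" k x] symp_form_basis_low)

text \<open>The vector \<open>u\<close> is orthogonal to the pairs already reduced, so its
  transvections fix them.\<close>

lemma agrees_with_basis_transvection:
  assumes "agrees_with_basis R k j c" "vanishes_below R k j u" "j \<le> k" "u \<in> vecs R k" "a \<in> carrier R"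
  shows "agrees_with_basis R k j (\<lambda>i. transvection R k u a (c i))"
  using assms
  by (auto simp: agrees_with_basis_def vanishes_below_def symp_form_high_right symp_form_low_right
      intro!: transvection_fixes)

text \<open>The coordinates of \<open>c m\<close> at \<open>i\<close> and \<open>k + i\<close> are,
  up to sign, its products with the basis vectors at \<open>k + i\<close> and \<open>i\<close>.
  These belong to the family already, and the index bounds make the corresponding entries of
  \<open>J\<close> zero.\<close>

lemma symp_family_vanishes_below:
  assumes "symp_family R k c" "agrees_with_basis R k j c" "j \<le> k" "m < 2 * k" "j \<le> m"
    "m < k \<or> k + j \<le> m"
  shows "vanishes_below R k j (c m)"
  unfolding vanishes_below_def
proof (intro allI impI)
  fix i assume "i < j"
  have m: "c m \<in> vecs R k"
    using assms by (simp add: symp_family_def)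
  have e: "c i = basis_vec R i" "c (k + i) = basis_vec R (k + i)"
    using assms(2) \<open>i < j\<close> by (simp_all add: agrees_with_basis_def)
  have J: "symp_form R k (c (k + i)) (c m) = J_entry R k (k + i) m"
    "symp_form R k (c i) (c m) = J_entry R k i m"
    using assms \<open>i < j\<close> by (simp_all add: symp_family_def)
  have "\<ominus> c m i = J_entry R k (k + i) m" "c m (k + i) = J_entry R k i m"
    using J symp_form_basis_high[of i k "c m"] symp_form_basis_low[of i k "c m"] m assms(3) \<open>i < j\<close>
    by (simp_all add: e)
  moreover have "J_entry R k (k + i) m = \<zero>" "J_entry R k i m = \<zero>"
    using assms \<open>i < j\<close> by (auto simp: J_entry_def)
  ultimately show "c m i = \<zero> \<and> c m (k + i) = \<zero>"
    using m by (metis minus_minus minus_zero vecs_carrier)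
qed

text \<open>
  Two vectors are linked by a single transvection as soon as their symplectic product is a unit,
  so \<open>z\<close> is a stepping stone from \<open>v\<close> to the \<open>j\<close>-th basis vector.
\<close>

lemma stable_range_stepping_stone:
  assumes sr: "stable_range_one R" and j: "j < k"
    and v: "v \<in> vecs R k" and d: "d \<in> vecs R k" and vd: "symp_form R k v d = \<one>"
  obtains z where "z \<in> vecs R k" "symp_form R k z v \<in> Units R"
    "symp_form R k (basis_vec R j) z \<in> Units R" "\<forall>l. l \<noteq> k + j \<longrightarrow> d l = \<zero> \<longrightarrow> z l = \<zero>"
proof -
  \<comment> \<open>Clearing the coordinate of \<open>d\<close> at \<open>k + j\<close> turns
    \<omega>(v, d) = 1 into a Bezout relation between \<open>v j\<close> and \<omega>(v, d'), to
    which stable range one applies.\<close>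
  define d' where "d' = add_scaled R d (\<ominus> d (k + j)) (basis_vec R (k + j))"
  have d': "d' \<in> vecs R k"
    using d j by (simp add: d'_def)
  have c: "v j \<in> carrier R" "d (k + j) \<in> carrier R" "symp_form R k v d' \<in> carrier R"
    using v d d' by auto
  have "symp_form R k v d' = \<one> \<oplus> \<ominus> d (k + j) \<otimes> v j"
    using v d j vd by (simp add: d'_def symp_form_add_scaled_right symp_form_high_right)
  then have "v j \<otimes> d (k + j) \<oplus> symp_form R k v d' = v j \<otimes> d (k + j) \<oplus> (\<one> \<oplus> \<ominus> d (k + j) \<otimes> v j)"
    by simp
  also have "\<dots> = \<one>"
    using c by algebra
  finally obtain t where t: "t \<in> carrier R" "v j \<oplus> t \<otimes> symp_form R k v d' \<in> Units R"
    using sr c unfolding stable_range_one_def by blast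
  \<comment> \<open>The basis vector contributes \<open>v j\<close> to \<omega>(v, z), which becomes
    the unit just found. Since \<open>d'\<close> is zero at \<open>k + j\<close>, the coordinate of
    \<open>z\<close> there is one, and this is \<omega>(e, z) for the \<open>j\<close>-th basis
    vector e.\<close>
  define z where "z = add_scaled R (basis_vec R (k + j)) t d'"
  have z: "z \<in> vecs R k"
    using t d' j by (simp add: z_def)
  have "symp_form R k v z = v j \<oplus> t \<otimes> symp_form R k v d'"
    using v d' t j by (simp add: z_def symp_form_add_scaled_right symp_form_high_right)
  then have 1: "symp_form R k z v \<in> Units R"
    using t v z by (simp add: symp_form_commute[of v k z] Units_uminus)
  have "d' (k + j) = \<zero>"
    using c by (simp add: d'_def add_scaled_def basis_vec_def r_neg)
  then have "symp_form R k (basis_vec R j) z = \<one>"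
    using z j t by (simp add: symp_form_basis_low) (simp add: z_def add_scaled_def basis_vec_def)
  then have 2: "symp_form R k (basis_vec R j) z \<in> Units R"
    by simp
  have 3: "\<forall>l. l \<noteq> k + j \<longrightarrow> d l = \<zero> \<longrightarrow> z l = \<zero>"
    using c t by (simp add: z_def d'_def add_scaled_def basis_vec_def)
  show thesis
    by (rule that[OF z 1 2 3])
qed

lemma vanishes_below_add_scaled:
  assumes "vanishes_below R k j x" "vanishes_below R k j u" "a \<in> carrier R"
  shows "vanishes_below R k j (add_scaled R x a u)"
  using assms by (simp add: vanishes_below_def add_scaled_def)

lemma vanishes_below_basis_vec:
  assumes "m = j \<or> m = k + j" "j < k"
  shows "vanishes_below R k j (basis_vec R m)"
  using assms by (auto simp: vanishes_below_def basis_vec_def)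

text \<open>The predicate \<open>Q\<close> can be pulled back along any transvection, which replaces
  explicit products of transvections. Four of them reduce the \<open>j\<close>-th pair; they are
  treated in reverse order, \<open>Q_ef\<close> being the last and \<open>Q_e\<close> the
  third.\<close>

lemma symp_family_extend_basis:
  assumes sr: "stable_range_one R" and "j < k"
    and step: "\<And>u a c. \<lbrakk>u \<in> vecs R k; a \<in> carrier R; symp_family R k c;
        Q (\<lambda>i. transvection R k u a (c i))\<rbrakk> \<Longrightarrow> Q c"
    and next_basis: "\<And>c. symp_family R k c \<Longrightarrow> agrees_with_basis R k (Suc j) c \<Longrightarrow> Q c"
    and c: "symp_family R k c" "agrees_with_basis R k j c"
  shows "Q c"
proof -
  let ?e = "basis_vec R j" and ?f = "basis_vec R (k + j)"
  have ef: "?e \<in> vecs R k" "?f \<in> vecs R k" "vanishes_below R k j ?e" "vanishes_below R k j ?f"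
    using \<open>j < k\<close> by (simp_all add: vanishes_below_basis_vec)
  have fam: "b m \<in> vecs R k" "vanishes_below R k j (b m)" "symp_form R k (b j) (b (k + j)) = \<one>"
    if "symp_family R k b" "agrees_with_basis R k j b" "m = j \<or> m = k + j" for b m
    using that \<open>j < k\<close> symp_family_vanishes_below[of k b j m]
    by (auto simp: symp_family_def J_entry_def)
  note T = symp_family_transvection agrees_with_basis_transvection[OF _ _ less_imp_le[OF \<open>j < k\<close>]]

  have Q_ef: "Q b" if b: "symp_family R k b" "agrees_with_basis R k j b" "b j = ?e" "b (k + j) j = \<one>" for b
  proof -
    let ?w = "b (k + j)"
    let ?u = "add_scaled R ?f (\<ominus> \<one>) ?w"
    let ?a = "inv (symp_form R k ?f ?w)"
    let ?b = "\<lambda>i. transvection R k ?u ?a (b i)"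
    note w = fam[OF b(1,2) disjI2[OF refl]]
    \<comment> \<open>The product is the negative of \<open>?w j\<close>, which is one by
      assumption; the third transvection exists to arrange this.\<close>
    have unit: "symp_form R k ?f ?w \<in> Units R"
      using \<open>j < k\<close> w b(4) by (simp add: symp_form_basis_high Units_uminus)
    have u: "?u \<in> vecs R k" "vanishes_below R k j ?u"
      using ef w by (simp_all add: vanishes_below_add_scaled)
    \<comment> \<open>Both \<open>?f\<close> and \<open>?w\<close> have coordinate one at
      \<open>k + j\<close>, so their difference is orthogonal to \<open>?e\<close> and its
      transvection keeps \<open>?e\<close> in place.\<close>
    have "?w (k + j) = \<one>"
      using w \<open>j < k\<close> b(3) by (simp add: symp_form_basis_low)
    then have "symp_form R k ?u ?e = \<zero>"
      using u \<open>j < k\<close> by (simp add: symp_form_low_right) (simp add: add_scaled_def basis_vec_def r_neg)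
    then have "?b j = ?e"
      using b(3) u ef unit by (simp add: transvection_fixes)
    moreover have "?b (k + j) = ?f"
      using w ef unit by (simp add: transvection_maps)
    moreover have "agrees_with_basis R k j ?b"
      by (rule T) (use b u unit in auto)
    ultimately have "agrees_with_basis R k (Suc j) ?b"
      by (auto simp: agrees_with_basis_def less_Suc_eq)
    then show "Q b"
      using u unit b T(1) by (intro step[of ?u ?a b] next_basis) auto
  qed

  have Q_e: "Q b" if b: "symp_family R k b" "agrees_with_basis R k j b" "b j = ?e" for b
  proof -
    let ?w = "b (k + j)"
    \<comment> \<open>As \<omega>(?e, ?w) = 1, the transvection along \<open>?e\<close> adds
      \<open>?a\<close> to the \<open>j\<close>-th coordinate of \<open>?w\<close>, making it one,
      and it fixes \<open>?e\<close>.\<close>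
    let ?a = "\<one> \<ominus> ?w j"
    let ?b = "\<lambda>i. transvection R k ?e ?a (b i)"
    note w = fam[OF b(1,2) disjI2[OF refl]]
    have wj: "?w j \<in> carrier R" using w by simp
    have "symp_form R k ?e ?w = \<one>"
      using w b(3) by simp
    then have "?b (k + j) j = ?w j \<oplus> (\<one> \<ominus> ?w j)"
      using wj by (simp add: transvection_def) (simp add: add_scaled_def basis_vec_def)
    also have "\<dots> = \<one>"
      using wj by algebra
    finally have "?b (k + j) j = \<one>" .
    moreover have "?b j = ?e"
      using b(3) ef wj by (simp add: transvection_fixes)
    moreover have "symp_family R k ?b" "agrees_with_basis R k j ?b"
      using T b ef wj by auto
    ultimately have "Q ?b"
      by (intro Q_ef)
    then show "Q b"
      using ef wj b by (intro step[of ?e ?a b]) auto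
  qed

  note v = fam[OF c disjI1[OF refl]] and d = fam[OF c disjI2[OF refl]]
  obtain z where z: "z \<in> vecs R k" "symp_form R k z (c j) \<in> Units R"
      "symp_form R k ?e z \<in> Units R" "\<forall>l. l \<noteq> k + j \<longrightarrow> c (k + j) l = \<zero> \<longrightarrow> z l = \<zero>"
    by (rule stable_range_stepping_stone[OF sr \<open>j < k\<close> v(1) d(1) v(3)])
  \<comment> \<open>The only coordinate where \<open>z\<close> may be nonzero while
    \<open>c (k + j)\<close> is zero is \<open>k + j\<close>, which \<open>vanishes_below\<close> at
    level \<open>j\<close> does not test.\<close>
  have zv: "vanishes_below R k j z"
    using d(2) z(4) \<open>j < k\<close> by (simp add: vanishes_below_def)

  \<comment> \<open>The first two transvections move \<open>c j\<close> to \<open>z\<close> and then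
    \<open>z\<close> to \<open>?e\<close>.\<close>
  let ?u1 = "add_scaled R z (\<ominus> \<one>) (c j)" and ?a1 = "inv (symp_form R k z (c j))"
  let ?c1 = "\<lambda>i. transvection R k ?u1 ?a1 (c i)"
  let ?u2 = "add_scaled R ?e (\<ominus> \<one>) z" and ?a2 = "inv (symp_form R k ?e z)"
  let ?c2 = "\<lambda>i. transvection R k ?u2 ?a2 (?c1 i)"
  have u: "?u1 \<in> vecs R k" "vanishes_below R k j ?u1" "?u2 \<in> vecs R k" "vanishes_below R k j ?u2"
    using z zv v ef by (simp_all add: vanishes_below_add_scaled)
  have c1: "symp_family R k ?c1" "agrees_with_basis R k j ?c1"
    using T c u z by auto
  have "?c1 j = z"
    using v z by (simp add: transvection_maps)
  then have "?c2 j = ?e"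
    using ef z by (simp add: transvection_maps)
  moreover have "symp_family R k ?c2" "agrees_with_basis R k j ?c2"
    using T(1)[OF c1(1) u(3), of ?a2] T(2)[OF c1(2) u(4,3), of ?a2] z by auto
  ultimately have "Q ?c2"
    by (intro Q_e)
  then have "Q ?c1"
    using step[of ?u2 ?a2 ?c1] u z c1 by simp
  then show "Q c"
    using step[of ?u1 ?a1 c] u z c by simp
qed

text \<open>Generation by transvections in the form of an induction rule. The premise
  \<open>basis\<close> covers every family that is standard below \<open>2 * k\<close>, because
  later indices are arbitrary.\<close>

lemma symp_family_transvection_induct:
  assumes sr: "stable_range_one R"
    and step: "\<And>u a c. \<lbrakk>u \<in> vecs R k; a \<in> carrier R; symp_family R k c;
        Q (\<lambda>i. transvection R k u a (c i))\<rbrakk> \<Longrightarrow> Q c"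
    and basis: "\<And>c. \<forall>i<2 * k. c i = basis_vec R i \<Longrightarrow> Q c"
    and c: "symp_family R k c"
  shows "Q c"
proof -
  have "Q c" if "j \<le> k" "symp_family R k c" "agrees_with_basis R k j c" for j c
    using that
  \<comment> \<open>The induction descends from \<open>k\<close>, where the whole basis has been
    reached, to zero, where agreement is vacuous.\<close>
  proof (induction j arbitrary: c rule: inc_induct)
    case base
    have "c i = basis_vec R i" if "i < 2 * k" for i
    proof (cases "i < k")
      case False
      then have "i = k + (i - k)" "i - k < k"
        using that by auto
      then show ?thesis
        using base unfolding agrees_with_basis_def by metis
    qed (use base in \<open>simp add: agrees_with_basis_def\<close>)
    then show ?case by (simp add: basis)
  next
    case (step j)
    show ?case
      by (rule symp_family_extend_basis[OF sr \<open>j < k\<close>, of Q])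
        (use step assms(2) in auto)
  qed
  from this[of 0] c show ?thesis
    by (simp add: agrees_with_basis_def)
qed

end

section \<open>Ring homomorphisms and lifting of symplectic families\<close>

context ring_hom_cring
begin

lemma hom_vecs: "x \<in> vecs R k \<Longrightarrow> h \<circ> x \<in> vecs S k"
  by (auto simp: vecs_def simp del: R.vecs_carrier S.vecs_carrier)

lemma hom_minus: "x \<in> carrier R \<Longrightarrow> y \<in> carrier R \<Longrightarrow> h (x \<ominus> y) = h x \<ominus>\<^bsub>S\<^esub> h y"
  by (simp add: a_minus_def)

lemma hom_symp_form:
  assumes "x \<in> vecs R k" "y \<in> vecs R k"
  shows "h (symp_form R k x y) = symp_form S k (h \<circ> x) (h \<circ> y)"
proof -
  have "h (symp_form R k x y) =
      (\<Oplus>\<^bsub>S\<^esub>i\<in>{..<k}. (h \<circ> (\<lambda>i. x i \<otimes> y (k + i) \<ominus> x (k + i) \<otimes> y i)) i)"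
    unfolding symp_form_def using assms by (intro hom_finsum) auto
  also have "\<dots> = symp_form S k (h \<circ> x) (h \<circ> y)"
    unfolding symp_form_def using assms by (intro S.finsum_cong') (auto simp: hom_minus)
  finally show ?thesis .
qed

lemma hom_transvection:
  assumes "x \<in> vecs R k" "u \<in> vecs R k" "a \<in> carrier R"
  shows "h \<circ> transvection R k u a x = transvection S k (h \<circ> u) (h a) (h \<circ> x)"
  using assms by (simp add: transvection_def add_scaled_def fun_eq_iff hom_symp_form)

lemma hom_J_entry: "h (J_entry R k i j) = J_entry S k i j"
  by (simp add: J_entry_def)

lemma hom_symp_family:
  assumes "symp_family R k c"
  shows "symp_family S k (\<lambda>i. h \<circ> c i)"
  using assms by (simp add: symp_family_def hom_vecs hom_symp_form[symmetric] hom_J_entry)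

lemma vecs_lift:
  assumes "h ` carrier R = carrier S" "x \<in> vecs S k"
  obtains x' where "x' \<in> vecs R k" "h \<circ> x' = x"
proof -
  \<comment> \<open>Beyond index \<open>2 * k\<close> the preimage zero is prescribed, so that the
    lift is again in \<open>vecs R k\<close>.\<close>
  have "\<forall>l. \<exists>y. y \<in> carrier R \<and> h y = x l \<and> (2 * k \<le> l \<longrightarrow> y = \<zero>)"
  proof
    fix l
    have "x l \<in> h ` carrier R"
      using assms by simp
    then show "\<exists>y. y \<in> carrier R \<and> h y = x l \<and> (2 * k \<le> l \<longrightarrow> y = \<zero>)"
      using assms(2)
      by (cases "2 * k \<le> l") (auto simp: vecs_def simp del: R.vecs_carrier S.vecs_carrier)
  qed
  then obtain x' where "\<forall>l. x' l \<in> carrier R \<and> h (x' l) = x l \<and> (2 * k \<le> l \<longrightarrow> x' l = \<zero>)"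
    by metis
  then show thesis
    by (intro that[of x']) (auto simp: vecs_def fun_eq_iff simp del: R.vecs_carrier S.vecs_carrier)
qed

text \<open>Transvections lift along with their parameters, and the lift is again symplectic.\<close>

lemma symp_family_lift:
  assumes surj: "h ` carrier R = carrier S" and sr: "stable_range_one S"
    and c: "symp_family S k c"
  shows "\<exists>c'. symp_family R k c' \<and> (\<forall>i<2 * k. h \<circ> c' i = c i)"
  using c
proof (rule S.symp_family_transvection_induct[OF sr, rotated 2])
  fix c assume "\<forall>i<2 * k. c i = basis_vec S i"
  moreover have "h \<circ> basis_vec R i = basis_vec S i" for i
    by (auto simp: basis_vec_def)
  ultimately show "\<exists>c'. symp_family R k c' \<and> (\<forall>i<2 * k. h \<circ> c' i = c i)"
    using R.symp_family_basis[of k] by auto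
next
  fix u a c
  assume u: "u \<in> vecs S k" and a: "a \<in> carrier S" and c: "symp_family S k c"
    and "\<exists>c'. symp_family R k c' \<and> (\<forall>i<2 * k. h \<circ> c' i = transvection S k u a (c i))"
  then obtain c' where c': "symp_family R k c'" "\<And>i. i < 2 * k \<Longrightarrow> h \<circ> c' i = transvection S k u a (c i)"
    by blast
  obtain u' where u': "u' \<in> vecs R k" "h \<circ> u' = u"
    using vecs_lift[OF surj u] .
  obtain a' where a': "a' \<in> carrier R" "h a' = a"
    using a unfolding surj[symmetric] by auto
  \<comment> \<open>The family \<open>c'\<close> lifts the transvected family, so the inverse
    transvection with lifted parameters yields a lift of \<open>c\<close>.\<close>
  have "h \<circ> transvection R k u' (\<ominus> a') (c' i) = c i" if "i < 2 * k" for i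
  proof -
    have "h \<circ> transvection R k u' (\<ominus> a') (c' i) = transvection S k u (\<ominus>\<^bsub>S\<^esub> a) (transvection S k u a (c i))"
      using that c' u' a' by (simp add: hom_transvection symp_family_def)
    also have "\<dots> = c i"
      using that c u a by (simp add: S.transvection_inverse symp_family_def)
    finally show ?thesis .
  qed
  then show "\<exists>c'. symp_family R k c' \<and> (\<forall>i<2 * k. h \<circ> c' i = c i)"
    using R.symp_family_transvection[OF c'(1) u'(1), of "\<ominus> a'"] a' by auto
qed

end

section \<open>From the USC to stable range one of the quotient\<close>

lemma carrier_Quot: "carrier (R Quot I) = (\<lambda>x. I +>\<^bsub>R\<^esub> x) ` carrier R"
  by (auto simp: FactRing_def A_RCOSETS_def')

lemma (in cring) USC_imp_stable_range_one:
  assumes I: "ideal I R" and usc: "USC R I"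
  shows "stable_range_one (R Quot I)"
  unfolding stable_range_one_def
proof (intro ballI impI)
  interpret I: ideal I R by (rule I)
  interpret Q: cring "R Quot I"
    by (rule I.quotient_is_cring[OF is_cring])
  interpret homc: ring_hom_cring R "R Quot I" "(+>) I"
    by (rule I.rcos_ring_hom_cring[OF is_cring])
  fix x p r
  assume xpr: "x \<in> carrier (R Quot I)" "p \<in> carrier (R Quot I)" "r \<in> carrier (R Quot I)"
    and eq: "x \<otimes>\<^bsub>R Quot I\<^esub> p \<oplus>\<^bsub>R Quot I\<^esub> r = \<one>\<^bsub>R Quot I\<^esub>"
  from xpr obtain x' p' r' where lift: "x' \<in> carrier R" "p' \<in> carrier R" "r' \<in> carrier R"
      "I +> x' = x" "I +> p' = p" "I +> r' = r"
    unfolding carrier_Quot by blast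
  \<comment> \<open>The defect of the lifted Bezout relation; it is zero modulo
    \<open>I\<close>.\<close>
  define s where "s = \<one> \<ominus> (x' \<otimes> p' \<oplus> r')"
  have s: "s \<in> carrier R"
    using lift by (simp add: s_def)
  have one: "\<one> = x' \<otimes> p' \<oplus> r' \<oplus> s"
    using lift unfolding s_def by algebra
  have s_zero: "I +> s = \<zero>\<^bsub>R Quot I\<^esub>"
  proof -
    have "I +> s = \<one>\<^bsub>R Quot I\<^esub> \<ominus>\<^bsub>R Quot I\<^esub> \<one>\<^bsub>R Quot I\<^esub>"
      using lift eq xpr by (simp add: s_def homc.hom_minus)
    then show ?thesis by (simp add: Q.r_neg a_minus_def)
  qed
  \<comment> \<open>Adjoining \<open>s \<in> I\<close> turns a row that is unimodular only modulo \<open>I\<close> into a unital list.\<close>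
  let ?as = "[x', r', s]"
  have sub: "set ?as \<subseteq> carrier R"
    using lift s by simp
  interpret G: ideal "Idl (set ?as)" R
    using sub by (rule genideal_ideal)
  have "x' \<in> Idl (set ?as)" "r' \<in> Idl (set ?as)" "s \<in> Idl (set ?as)"
    using genideal_self[OF sub] by auto
  then have "x' \<otimes> p' \<oplus> r' \<oplus> s \<in> Idl (set ?as)"
    using lift by (intro G.a_closed G.I_r_closed)
  then have "Idl (set ?as) = carrier R"
    unfolding one[symmetric] by (rule G.one_imp_carrier)
  then have "unital R ?as"
    using sub by (simp add: unital_def)
  then obtain b where b: "b \<in> Idl {r', s}" "I +> (x' \<oplus> b) \<in> Units (R Quot I)"
    using usc unfolding USC_def by force
  \<comment> \<open>The preimage of the principal ideal of \<open>r\<close> is an ideal containing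
    \<open>r'\<close> and \<open>s\<close>, hence \<open>b\<close>. So \<open>b\<close> is a
    multiple of \<open>r\<close> modulo \<open>I\<close>, and the multiplier is the required
    \<open>t\<close>.\<close>
  let ?P = "{b \<in> carrier R. I +> b \<in> PIdl\<^bsub>R Quot I\<^esub> r}"
  have "ideal ?P R"
    using ring_hom_ring.ideal_vimage[OF I.rcos_ring_hom_ring Q.cgenideal_ideal[OF xpr(3)]] .
  moreover have "{r', s} \<subseteq> ?P"
    using lift s s_zero xpr Q.cgenideal_self[OF xpr(3)]
      additive_subgroup.zero_closed[OF ideal.axioms(1)[OF Q.cgenideal_ideal[OF xpr(3)]]]
    by auto
  ultimately have "b \<in> ?P"
    using b(1) genideal_minimal by blast
  then obtain t where t: "t \<in> carrier (R Quot I)" "I +> b = t \<otimes>\<^bsub>R Quot I\<^esub> r" "b \<in> carrier R"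
    by (auto simp: cgenideal_def)
  then have "x \<oplus>\<^bsub>R Quot I\<^esub> t \<otimes>\<^bsub>R Quot I\<^esub> r \<in> Units (R Quot I)"
    using b(2) lift by simp
  then show "\<exists>t\<in>carrier (R Quot I). x \<oplus>\<^bsub>R Quot I\<^esub> t \<otimes>\<^bsub>R Quot I\<^esub> r \<in> Units (R Quot I)"
    using t by blast
qed

section \<open>Symplectic matrices as families of columns\<close>

definition col_fun :: "('a, 'm) ring_scheme \<Rightarrow> nat \<Rightarrow> 'a mat \<Rightarrow> nat \<Rightarrow> nat \<Rightarrow> 'a" where
  "col_fun R k A i = (\<lambda>l. if l < 2 * k then A $$ (l, i) else \<zero>\<^bsub>R\<^esub>)"

context cring
begin

lemma symp_J_carrier: "symp_J R k \<in> carrier_mat (2 * k) (2 * k)"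
  unfolding symp_J_def mult_2
  by (rule four_block_carrier_mat) (auto simp: zero_mat_over_def)

lemma symp_J_index:
  assumes "i < 2 * k" "j < 2 * k"
  shows "symp_J R k $$ (i, j) = J_entry R k i j"
  using assms
  by (auto simp: symp_J_def J_entry_def zero_mat_over_def one_mat_over_def uminus_mat_over_def)

text \<open>Column \<open>l\<close> of \<open>J\<close> has a single entry outside its zeros: minus
  one in row \<open>k + l\<close> if \<open>l < k\<close>, and one in row \<open>l - k\<close>
  otherwise.\<close>

lemma mult_J_index:
  assumes A: "A \<in> mats_over R (2 * k) (2 * k)" and ij: "i < 2 * k" "l < 2 * k"
  shows "mult_mat_over R (transpose_mat A) (symp_J R k) $$ (i, l) =
    (if l < k then \<ominus> A $$ (k + l, i) else A $$ (l - k, i))"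
proof -
  have A': "A \<in> carrier_mat (2 * k) (2 * k)" "\<And>m. m < 2 * k \<Longrightarrow> A $$ (m, i) \<in> carrier R"
    using A ij by (auto simp: mats_over_def)
  have "mult_mat_over R (transpose_mat A) (symp_J R k) $$ (i, l) =
      (\<Oplus>m\<in>{..<2 * k}. transpose_mat A $$ (i, m) \<otimes> symp_J R k $$ (m, l))"
    using A' ij symp_J_carrier[of k] by (simp add: mult_mat_over_def)
  also have "\<dots> = (\<Oplus>m\<in>{..<2 * k}. if (if l < k then k + l else l - k) = m
      then (if l < k then \<ominus> A $$ (m, i) else A $$ (m, i)) else \<zero>)"
    by (rule finsum_cong') (use A' ij in \<open>auto simp: symp_J_index J_entry_def r_minus\<close>)
  also have "\<dots> = (if l < k then \<ominus> A $$ (k + l, i) else A $$ (l - k, i))"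
    using A' ij by (subst finsum_singleton) auto
  finally show ?thesis .
qed

lemma mult_transpose_J_index:
  assumes A: "A \<in> mats_over R (2 * k) (2 * k)" and ij: "i < 2 * k" "j < 2 * k"
  shows "mult_mat_over R (mult_mat_over R (transpose_mat A) (symp_J R k)) A $$ (i, j) =
    symp_form R k (col_fun R k A i) (col_fun R k A j)"
proof -
  let ?B = "mult_mat_over R (transpose_mat A) (symp_J R k)"
  let ?f = "\<lambda>l. (if l < k then \<ominus> A $$ (k + l, i) else A $$ (l - k, i)) \<otimes> A $$ (l, j)"
  have A': "A \<in> carrier_mat (2 * k) (2 * k)" "\<And>m. m < 2 * k \<Longrightarrow> A $$ (m, i) \<in> carrier R"
      "\<And>m. m < 2 * k \<Longrightarrow> A $$ (m, j) \<in> carrier R"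
    using A ij by (auto simp: mats_over_def)
  have f: "?f \<in> {..<2 * k} \<rightarrow> carrier R"
    using A' by auto
  have "mult_mat_over R ?B A $$ (i, j) = (\<Oplus>l\<in>{..<2 * k}. ?B $$ (i, l) \<otimes> A $$ (l, j))"
    unfolding mult_mat_over_def[of R ?B A] using A' ij symp_J_carrier[of k]
    by (simp add: mult_mat_over_def)
  also have "\<dots> = (\<Oplus>l\<in>{..<2 * k}. ?f l)"
    by (rule finsum_cong'[OF refl f]) (use ij in \<open>simp add: mult_J_index[OF A]\<close>)
  \<comment> \<open>Splitting the sum into halves pairs the terms at \<open>l\<close> and
    \<open>k + l\<close>, which together form one summand of the symplectic form.\<close>
  also have "{..<2 * k} = {..<k} \<union> (+) k ` {..<k}"
    by (auto simp: lessThan_atLeast0 image_add_atLeastLessThan)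
  also have "(\<Oplus>l\<in>{..<k} \<union> (+) k ` {..<k}. ?f l) = (\<Oplus>l\<in>{..<k}. ?f l) \<oplus> (\<Oplus>l\<in>(+) k ` {..<k}. ?f l)"
    using A' by (intro finsum_Un_disjoint) auto
  also have "(\<Oplus>l\<in>(+) k ` {..<k}. ?f l) = (\<Oplus>l\<in>{..<k}. ?f (k + l))"
    using A' by (intro finsum_reindex) auto
  also have "(\<Oplus>l\<in>{..<k}. ?f l) \<oplus> (\<Oplus>l\<in>{..<k}. ?f (k + l)) = (\<Oplus>l\<in>{..<k}. ?f l \<oplus> ?f (k + l))"
    using A' by (intro finsum_addf[symmetric]) auto
  also have "\<dots> = symp_form R k (col_fun R k A i) (col_fun R k A j)"
    unfolding symp_form_def
  proof (rule finsum_cong'[OF refl])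
    fix l assume "l \<in> {..<k}"
    then have "A $$ (l, i) \<in> carrier R" "A $$ (k + l, i) \<in> carrier R"
      "A $$ (l, j) \<in> carrier R" "A $$ (k + l, j) \<in> carrier R"
      using A' by auto
    then have "\<ominus> A $$ (k + l, i) \<otimes> A $$ (l, j) \<oplus> A $$ (l, i) \<otimes> A $$ (k + l, j) =
      A $$ (l, i) \<otimes> A $$ (k + l, j) \<ominus> A $$ (k + l, i) \<otimes> A $$ (l, j)"
      by algebra
    then show "?f l \<oplus> ?f (k + l) = col_fun R k A i l \<otimes> col_fun R k A j (k + l) \<ominus>
        col_fun R k A i (k + l) \<otimes> col_fun R k A j l"
      using \<open>l \<in> {..<k}\<close> by (simp add: col_fun_def)
  qed (use A' in \<open>auto simp: col_fun_def\<close>)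
  finally show ?thesis .
qed

text \<open>The entries of the triple product are the symplectic products of the columns. This
  passes between matrices and the families to which the lifting result applies.\<close>

lemma SP_iff_symp_family:
  "A \<in> SP R k \<longleftrightarrow> A \<in> mats_over R (2 * k) (2 * k) \<and> symp_family R k (col_fun R k A)"
proof (cases "A \<in> mats_over R (2 * k) (2 * k)")
  case True
  then have A: "A \<in> carrier_mat (2 * k) (2 * k)"
    by (simp add: mats_over_def)
  have vecs: "\<forall>i<2 * k. col_fun R k A i \<in> vecs R k"
    using True by (auto simp: mats_over_def col_fun_def vecs_def simp del: vecs_carrier)
  let ?M = "mult_mat_over R (mult_mat_over R (transpose_mat A) (symp_J R k)) A"
  have M: "?M \<in> carrier_mat (2 * k) (2 * k)"
    using A by (simp add: mult_mat_over_def)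
  have "?M = symp_J R k \<longleftrightarrow> (\<forall>i<2 * k. \<forall>j<2 * k. ?M $$ (i, j) = symp_J R k $$ (i, j))"
    using M symp_J_carrier[of k] by (auto intro!: eq_matI)
  also have "\<dots> \<longleftrightarrow> symp_family R k (col_fun R k A)"
    using vecs True by (simp add: symp_family_def mult_transpose_J_index symp_J_index)
  finally show ?thesis
    using True by (simp add: SP_def)
qed (simp add: SP_def)

end

text \<open>Equality of sets expresses both that reduction lands in the symplectic group of the
  quotient and that it is onto. The first holds because the homomorphism preserves the form, the
  second by lifting the columns.\<close>

theorem mainTheorem2:
  fixes R :: "('a, 'm) ring_scheme" and I :: "'a set" and k :: nat
  assumes "cring R"
    and "ideal I R"
    and "I \<noteq> carrier R"
    and "USC R I"
  shows "reduction_map R I ` SP R k = SP (R Quot I) k"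
proof -
  interpret R: cring R by fact
  interpret I: ideal I R by fact
  interpret Q: cring "R Quot I"
    by (rule I.quotient_is_cring[OF assms(1)])
  interpret hom: ring_hom_cring R "R Quot I" "(+>\<^bsub>R\<^esub>) I"
    by (rule I.rcos_ring_hom_cring[OF assms(1)])
  have surj: "(+>\<^bsub>R\<^esub>) I ` carrier R = carrier (R Quot I)"
    by (rule carrier_Quot[symmetric])
  \<comment> \<open>Reduction acts columnwise, and the zero padding of \<open>col_fun\<close> is
    respected because the homomorphism sends zero to zero.\<close>
  have col: "col_fun (R Quot I) k (reduction_map R I A) i = (+>\<^bsub>R\<^esub>) I \<circ> col_fun R k A i"
    if "A \<in> mats_over R (2 * k) (2 * k)" "i < 2 * k" for A i
    using that hom.hom_zero by (auto simp: col_fun_def reduction_map_def mats_over_def fun_eq_iff)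
  show ?thesis
  proof (intro equalityI subsetI)
    fix B assume "B \<in> reduction_map R I ` SP R k"
    then obtain A where A: "A \<in> mats_over R (2 * k) (2 * k)" "symp_family R k (col_fun R k A)"
        and B: "B = reduction_map R I A"
      by (auto simp: R.SP_iff_symp_family)
    have "B \<in> mats_over (R Quot I) (2 * k) (2 * k)"
      using A(1) B by (auto simp: mats_over_def reduction_map_def)
    moreover have "symp_family (R Quot I) k (col_fun (R Quot I) k B)"
      using hom.hom_symp_family[OF A(2)] A(1) by (simp add: B symp_family_def col)
    ultimately show "B \<in> SP (R Quot I) k"
      by (simp add: Q.SP_iff_symp_family)
  next
    fix B assume "B \<in> SP (R Quot I) k"
    then have B: "B \<in> carrier_mat (2 * k) (2 * k)" "symp_family (R Quot I) k (col_fun (R Quot I) k B)"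
      by (auto simp: Q.SP_iff_symp_family mats_over_def)
    then obtain c where c: "symp_family R k c"
        "\<And>i. i < 2 * k \<Longrightarrow> (+>\<^bsub>R\<^esub>) I \<circ> c i = col_fun (R Quot I) k B i"
      using hom.symp_family_lift[OF surj R.USC_imp_stable_range_one[OF assms(2,4)]] by blast
    \<comment> \<open>The lifted vectors become the columns, hence \<open>c i l\<close> stands in
      row \<open>l\<close> and column \<open>i\<close>.\<close>
    let ?A = "mat (2 * k) (2 * k) (\<lambda>(l, i). c i l)"
    have cv: "c i \<in> vecs R k" if "i < 2 * k" for i
      using c(1) that by (simp add: symp_family_def)
    have A: "?A \<in> mats_over R (2 * k) (2 * k)"
      using R.vecs_carrier[OF cv] by (auto simp: mats_over_def)
    have "col_fun R k ?A i = c i" if "i < 2 * k" for i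
      using that cv[OF that] by (auto simp: col_fun_def vecs_def fun_eq_iff simp del: R.vecs_carrier Q.vecs_carrier)
    then have "?A \<in> SP R k"
      using A c(1) by (simp add: R.SP_iff_symp_family symp_family_def)
    moreover have "reduction_map R I ?A = B"
    proof (rule eq_matI)
      fix l i assume "l < dim_row B" "i < dim_col B"
      then show "reduction_map R I ?A $$ (l, i) = B $$ (l, i)"
        using B(1) fun_cong[OF c(2)[of i], of l] by (simp add: reduction_map_def col_fun_def)
    qed (use B(1) in \<open>auto simp: reduction_map_def\<close>)
    ultimately show "B \<in> reduction_map R I ` SP R k"
      by blast
  qed
qed

end
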